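(* Let $k\geq 4$. Let $\bar r=(r_1,\ldots,r_k)$ with $r_i\geq 1$ for all $i$, and let $0\leq\alpha\leq\sum_{i=1}^k r_i-2$. Let $m\in[1,k]$ be the integer with $\sum_{i=1}^{m-1} r_i\leq\alpha<\sum_{i=1}^m r_i$. Let $\mathcal{A}=(a_1,\ldots,a_k)_{\bar r}$ be a finite sequence of integers with $0<a_1<a_2<\cdots<a_k$ and \[|\Sigma_{\alpha}(\bar r,\mathcal{A})|=\sum_{i=1}^k i r_i-\sum_{i=1}^m i r_i+m\left(\sum_{i=1}^m r_i-\alpha\right)+1.\] Then $\mathcal{A}=a_1*[1,k]_{\bar r}$.
   Context: For distinct integers $a_1,\ldots,a_k$ and $\bar r=(r_1,\ldots,r_k)$ with $r_i\geq 1$, $(a_1,\ldots,a_k)_{\bar r}$ denotes the finite sequence consisting of $r_i$ copies of $a_i$ for each $i$. For such a sequence $\mathcal{A}$ and an integer $0\leq\alpha\leq\sum_i r_i$, $\Sigma_{\alpha}(\bar r,\mathcal{A})$ is the set of sums $s(\mathcal{B})$ of all terms of $\mathcal{B}$, over all subsequences $\mathcal{B}$ of $\mathcal{A}$ of length at least $\alpha$ (the empty subsequence has sum $0$). For integers $a\leq b$ with $b-a+1=k$, $[a,b]_{\bar r}$ denotes the sequence $(a,a+1,\ldots,b)_{\bar r}$, and for a positive integer $c$, $c*(a_1,\ldots,a_k)_{\bar r}=(ca_1,\ldots,ca_k)_{\bar r}$. Empty sums are $0$. *)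

theory Defs
  imports "HOL-Library.Multiset"
begin

text \<open>
  A finite sequence of integers with repetitions is modelled as a multiset, and a subsequence as
  a submultiset: only multiplicities, lengths and sums of terms matter. The vectors
  \<open>(a\<^sub>1, \<dots>, a\<^sub>k)\<close> and \<open>(r\<^sub>1, \<dots>, r\<^sub>k)\<close> are functions on \<^typ>\<open>nat\<close> of which only the values at
  indices in \<open>{1..k}\<close> are used.
\<close>

definition rep_seq :: "nat \<Rightarrow> (nat \<Rightarrow> int) \<Rightarrow> (nat \<Rightarrow> nat) \<Rightarrow> int multiset" where
  "rep_seq k a r = (\<Sum>i=1..k. replicate_mset (r i) (a i))"

definition interval_seq :: "int \<Rightarrow> int \<Rightarrow> (nat \<Rightarrow> nat) \<Rightarrow> int multiset" where
  "interval_seq a b r = rep_seq (nat (b - a + 1)) (\<lambda>i. a + (int i - 1)) r"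

definition dilate_seq :: "int \<Rightarrow> int multiset \<Rightarrow> int multiset" where
  "dilate_seq c A = image_mset (\<lambda>x. c * x) A"

text \<open>
  The multiplicity vector is determined by the sequence, so it is not a separate argument here.
\<close>

definition subseq_sums :: "nat \<Rightarrow> int multiset \<Rightarrow> int set" where
  "subseq_sums \<alpha> A = {\<Sum>\<^sub># B | B. B \<subseteq># A \<and> \<alpha> \<le> size B}"

end

theory Submission
  imports Defs
begin

text \<open>
  Describe a subsequence by its vector \<open>b\<close> of multiplicities and give it the rank \<open>\<Sum>i. i * b i\<close>.
  Moving one chosen term from \<open>a i\<close> to \<open>a (i + 1)\<close>, or adding a copy of \<open>a 1\<close>, raises the rank by
  exactly 1 and strictly raises the sum. Every vector can be moved up in this way until the whole
  sequence is reached, and down until the \<open>\<alpha>\<close> smallest terms remain. The prescribed cardinality is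
  the number of ranks on such a chain, so two vectors of equal rank must have equal sums.
  Comparing vectors that omit at most two terms gives, with \<open>a 0 = 0\<close>, that
  \<open>a i + a j = a i' + a j'\<close> whenever \<open>i + j = i' + j'\<close>, \<open>i \<noteq> j\<close> and \<open>i' \<noteq> j'\<close>. For \<open>k \<ge> 4\<close> these relations
  force \<open>a i = i * a 1\<close>.
\<close>

section \<open>Counting values along chains of unit rank steps\<close>

lemma card_below_graded:
  fixes \<rho> v :: "'c \<Rightarrow> int"
  assumes "finite S" "v ` C \<subseteq> S"
    and down: "\<And>c. c \<in> C \<Longrightarrow> \<mu> < \<rho> c \<Longrightarrow> \<exists>c'\<in>C. \<rho> c' = \<rho> c - 1 \<and> v c' < v c"
    and "c \<in> C"
  shows "\<rho> c - \<mu> \<le> int (card {x \<in> S. x < v c})"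
  using \<open>c \<in> C\<close>
proof (induction "nat (\<rho> c - \<mu>)" arbitrary: c)
  case 0
  then show ?case by simp
next
  case (Suc n)
  then obtain c' where c': "c' \<in> C" "\<rho> c' = \<rho> c - 1" "v c' < v c"
    using down[of c] by fastforce
  have "\<rho> c' - \<mu> \<le> int (card {x \<in> S. x < v c'})"
    using Suc.hyps(2) c' by (intro Suc.hyps(1)) auto
  \<comment> \<open>The element \<open>v c'\<close> of \<open>S\<close> lies only in the larger set,
    so every step down the chain accounts for a new value below \<open>v c\<close>.\<close>
  moreover have "{x \<in> S. x < v c'} \<subset> {x \<in> S. x < v c}"
    using c' assms(2) by force
  then have "card {x \<in> S. x < v c'} < card {x \<in> S. x < v c}"
    using assms(1) by (intro psubset_card_mono) auto
  ultimately show ?case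
    using c'(2) by linarith
qed

text \<open>If \<open>v p < v q\<close> at equal rank, a chain down from \<open>p\<close>, a chain
  up from \<open>q\<close> and the two values themselves would put \<open>\<nu> - \<mu> + 2\<close>
  elements into \<open>S\<close>, one too many.\<close>

lemma equal_rank_imp_equal_value:
  fixes \<rho> v :: "'c \<Rightarrow> int"
  assumes fin: "finite S" and sub: "v ` C \<subseteq> S"
    and down: "\<And>c. c \<in> C \<Longrightarrow> \<mu> < \<rho> c \<Longrightarrow> \<exists>c'\<in>C. \<rho> c' = \<rho> c - 1 \<and> v c' < v c"
    and up: "\<And>c. c \<in> C \<Longrightarrow> \<rho> c < \<nu> \<Longrightarrow> \<exists>c'\<in>C. \<rho> c' = \<rho> c + 1 \<and> v c < v c'"
    and card: "int (card S) \<le> \<nu> - \<mu> + 1"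
    and pq: "p \<in> C" "q \<in> C" "\<rho> p = \<rho> q"
  shows "v p = v q"
proof -
  have False if pq: "p \<in> C" "q \<in> C" "\<rho> p = \<rho> q" "v p < v q" for p q
  proof -
    have lo: "\<rho> p - \<mu> \<le> int (card {x \<in> S. x < v p})"
      using card_below_graded[OF fin sub down pq(1)] .
    \<comment> \<open>Negating both rank and value turns steps up into steps down, so the same count
      bounds the values above \<open>v q\<close>.\<close>
    have "- \<rho> q - - \<nu> \<le> int (card {x \<in> uminus ` S. x < - v q})"
      using sub up pq fin
      by (intro card_below_graded[where C = C and v = "\<lambda>c. - v c" and \<rho> = "\<lambda>c. - \<rho> c"]) force+
    moreover have "{x \<in> uminus ` S. x < - v q} = uminus ` {x \<in> S. v q < x}"
      by auto
    ultimately have hi: "\<nu> - \<rho> q \<le> int (card {x \<in> S. v q < x})"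
      by (simp add: card_image)
    have "card ({x \<in> S. x < v p} \<union> {v p, v q} \<union> {x \<in> S. v q < x}) \<le> card S"
      using sub pq fin by (intro card_mono) auto
    moreover have "card ({x \<in> S. x < v p} \<union> {v p, v q} \<union> {x \<in> S. v q < x})
        = card {x \<in> S. x < v p} + 2 + card {x \<in> S. v q < x}"
      using fin pq(4) by (subst card_Un_disjoint; force)+
    ultimately show False
      using lo hi card pq(3) by linarith
  qed
  then show ?thesis
    using pq by (metis linorder_neqE)
qed

section \<open>Subsequences as multiplicity vectors\<close>

definition mult_vectors :: "nat \<Rightarrow> (nat \<Rightarrow> nat) \<Rightarrow> nat \<Rightarrow> (nat \<Rightarrow> nat) set" where
  "mult_vectors k r \<alpha> = {b. (\<forall>i\<in>{1..k}. b i \<le> r i) \<and> \<alpha> \<le> (\<Sum>i=1..k. b i)}"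

text \<open>One functional serves for three quantities: the weights \<open>int\<close> give the
  rank, \<open>a\<close> the sum of the terms, and the constant 1 the length.\<close>

definition weighted_sum :: "nat \<Rightarrow> (nat \<Rightarrow> int) \<Rightarrow> (nat \<Rightarrow> nat) \<Rightarrow> int" where
  "weighted_sum k w b = (\<Sum>i=1..k. w i * int (b i))"

lemma weighted_sum_upd:
  assumes "i \<in> {1..k}"
  shows "weighted_sum k w (b(i := x)) = weighted_sum k w b + w i * (int x - int (b i))"
proof -
  have "(\<Sum>j\<in>{1..k} - {i}. w j * int ((b(i := x)) j)) = (\<Sum>j\<in>{1..k} - {i}. w j * int (b j))"
    by (rule sum.cong) auto
  then show ?thesis
    using assms by (simp add: weighted_sum_def sum.remove[of _ i] algebra_simps)
qed

text \<open>With the length written as a weighted sum, \<open>weighted_sum_upd\<close> also settles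
  membership of modified vectors.\<close>

lemma mult_vectors_iff:
  "b \<in> mult_vectors k r \<alpha> \<longleftrightarrow>
    (\<forall>i\<in>{1..k}. b i \<le> r i) \<and> int \<alpha> \<le> weighted_sum k (\<lambda>_. 1) b"
  by (auto simp: mult_vectors_def weighted_sum_def simp flip: of_nat_sum)

lemma rep_seq_Suc: "rep_seq (Suc k) a r = rep_seq k a r + replicate_mset (r (Suc k)) (a (Suc k))"
  by (simp add: rep_seq_def)

lemma size_rep_seq: "size (rep_seq k a r) = (\<Sum>i=1..k. r i)"
  by (induction k) (simp_all add: rep_seq_Suc, simp add: rep_seq_def)

lemma sum_mset_rep_seq: "\<Sum>\<^sub># (rep_seq k a r) = weighted_sum k a r"
  by (induction k)
    (simp_all add: rep_seq_Suc weighted_sum_def sum_mset_replicate_mset, simp add: rep_seq_def)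

lemma rep_seq_mono:
  assumes "\<forall>i\<in>{1..k}. b i \<le> r i"
  shows "rep_seq k a b \<subseteq># rep_seq k a r"
  using assms
proof (induction k)
  case 0
  then show ?case by (simp add: rep_seq_def)
next
  case (Suc k)
  moreover have "replicate_mset (b (Suc k)) x \<subseteq># replicate_mset (r (Suc k)) x" for x :: int
    using Suc.prems by (auto simp: subseteq_mset_def)
  ultimately show ?case
    by (simp add: rep_seq_Suc subset_mset.add_mono)
qed

lemma weighted_sum_in_subseq_sums:
  assumes "b \<in> mult_vectors k r \<alpha>"
  shows "weighted_sum k a b \<in> subseq_sums \<alpha> (rep_seq k a r)"
  using assms rep_seq_mono[of k b r a] size_rep_seq[of k a b] sum_mset_rep_seq[of k a b]
  by (auto simp: subseq_sums_def mult_vectors_def intro!: exI[of _ "rep_seq k a b"])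

lemma finite_subseq_sums: "finite (subseq_sums \<alpha> A)"
proof -
  have "subseq_sums \<alpha> A \<subseteq> sum_mset ` {B. B \<subseteq># A}"
    by (auto simp: subseq_sums_def)
  moreover have "finite {B. B \<subseteq># A}"
  proof -
    obtain xs where "A = mset xs" by (metis ex_mset)
    moreover have "{B. B \<subseteq># mset xs} \<subseteq> mset ` {ys. set ys \<subseteq> set xs \<and> length ys \<le> length xs}"
    proof
      fix B assume "B \<in> {B. B \<subseteq># mset xs}"
      moreover obtain ys where "B = mset ys" by (metis ex_mset)
      ultimately show "B \<in> mset ` {ys. set ys \<subseteq> set xs \<and> length ys \<le> length xs}"
        using set_mset_mono[of "mset ys" "mset xs"] size_mset_mono[of "mset ys" "mset xs"] by auto
    qed
    ultimately show ?thesis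
      using finite_lists_length_le[of "set xs"] by (auto intro: finite_subset)
  qed
  ultimately show ?thesis
    by (meson finite_imageI finite_subset)
qed

section \<open>Unit moves up and down in rank\<close>

lemma mult_vectors_up:
  assumes r: "\<forall>i\<in>{1..k}. r i \<ge> 1" and a: "0 < a 1" "strict_mono_on {1..k} a"
    and b: "b \<in> mult_vectors k r \<alpha>"
    and less: "weighted_sum k int b < weighted_sum k int r"
  shows "\<exists>b'\<in>mult_vectors k r \<alpha>. weighted_sum k int b' = weighted_sum k int b + 1
    \<and> weighted_sum k a b < weighted_sum k a b'"
proof -
  let ?P = "\<lambda>i. i \<in> {1..k} \<and> b i < r i"
  have "\<exists>i. ?P i"
  proof (rule ccontr)
    assume "\<not> ?thesis"
    then have "weighted_sum k int r \<le> weighted_sum k int b"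
      unfolding weighted_sum_def by (intro sum_mono mult_left_mono) (auto simp: not_less)
    with less show False by simp
  qed
  \<comment> \<open>Below the least index with room every index is full, hence nonempty because
    \<open>r\<close> is at least 1. So a copy can move up from the predecessor; at index 1 a copy is
    added instead.\<close>
  then obtain i where i: "?P i" and min: "\<And>j. j < i \<Longrightarrow> \<not> ?P j"
    using exists_least_iff[of ?P] by blast
  show ?thesis
  proof (cases "i = 1")
    case True
    then show ?thesis
      using i a b
      by (intro bexI[of _ "b(1 := b 1 + 1)"]) (auto simp: mult_vectors_iff weighted_sum_upd)
  next
    case False
    then obtain h where h: "i = Suc h" "h \<in> {1..k}"
      using i by (cases i) auto
    then have bh: "b h \<ge> 1"
      using min[of h] r by fastforce
    have "a h < a i"
      using a(2) h i by (auto simp: strict_mono_on_def)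
    moreover have "b h - 1 \<le> r h"
      using b h by (auto simp: mult_vectors_def intro: le_trans[OF diff_le_self])
    ultimately show ?thesis
      using i h b bh
      by (intro bexI[of _ "b(i := b i + 1, h := b h - 1)"])
        (auto simp: mult_vectors_iff weighted_sum_upd)
  qed
qed

text \<open>By \<open>step\<close> and \<open>base\<close> no downward move is possible, which
  forces \<open>b\<close> to consist of the \<open>\<alpha>\<close> smallest terms: full below
  \<open>m\<close>, empty above, the remainder at \<open>m\<close>. The bound is the rank of that
  vector.\<close>

lemma weighted_sum_minimal_le:
  assumes r: "\<forall>i\<in>{1..k}. r i \<ge> 1" and m: "m \<in> {1..k}"
    and lo: "(\<Sum>i=1..m-1. r i) \<le> \<alpha>" and hi: "\<alpha> < (\<Sum>i=1..m. r i)"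
    and b: "b \<in> mult_vectors k r \<alpha>"
    and step: "\<And>i. Suc i \<in> {1..k} \<Longrightarrow> 1 \<le> i \<Longrightarrow> b (Suc i) = 0 \<or> b i = r i"
    and base: "b 1 = 0 \<or> (\<Sum>i=1..k. b i) = \<alpha>"
  shows "weighted_sum k int b
    \<le> (\<Sum>i=1..m. int i * int (r i)) - int m * ((\<Sum>i=1..m. int (r i)) - int \<alpha>)"
proof -
  have le: "b i \<le> r i" if "i \<in> {1..k}" for i
    using b that by (auto simp: mult_vectors_def)
  \<comment> \<open>A shortfall propagates: an index with no copies is again below its
    \<open>r\<close>, so the next one is empty too.\<close>
  have zero: "b j = 0" if "b i < r i" "1 \<le> i" "i < j" "j \<le> k" for i j
    using that(3,4)
  proof (induction j)
    case (Suc j)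
    have "b j < r j"
    proof (cases "i = j")
      case False
      then have "b j = 0" using Suc by auto
      moreover have "j \<in> {1..k}" using Suc.prems that by auto
      ultimately show ?thesis using r by force
    qed (use that in simp)
    then show ?case
      using step[of j] Suc.prems that by auto
  qed auto
  \<comment> \<open>Otherwise \<open>b 1 = 0\<close>, all entries vanish by propagation, and the
    length 0 can only equal \<open>\<alpha>\<close>.\<close>
  have total: "(\<Sum>i=1..k. b i) = \<alpha>"
  proof (rule ccontr)
    assume neq: "\<not> ?thesis"
    then have "b 1 = 0" using base by simp
    moreover have "1 \<in> {1..k}" using m by auto
    ultimately have "b 1 < r 1" using r by force
    then have "b j = 0" if "j \<in> {1..k}" for j
      using that zero[of 1 j] \<open>b 1 = 0\<close> by (cases "j = 1") auto
    then show False
      using neq b by (simp add: mult_vectors_def)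
  qed
  have above: "b i = 0" if "m < i" "i \<le> k" for i
  proof (rule ccontr)
    assume "b i \<noteq> 0"
    then have "b j = r j" if "j \<in> {1..m}" for j
      using that zero[of j i] le[of j] \<open>m < i\<close> \<open>i \<le> k\<close> by force
    then have "(\<Sum>j=1..m. r j) = (\<Sum>j=1..m. b j)" by simp
    also have "\<dots> \<le> (\<Sum>j=1..k. b j)" using m by (intro sum_mono2) auto
    finally show False using total hi by simp
  qed
  have below: "b i = r i" if "1 \<le> i" "i < m" for i
  proof (rule ccontr)
    assume "b i \<noteq> r i"
    then have lt: "b i < r i" using le[of i] that m by force
    have "(\<Sum>j=1..k. b j) = (\<Sum>j=1..m-1. b j)"
      using zero[OF lt] that m by (intro sum.mono_neutral_right) auto
    also have "\<dots> < (\<Sum>j=1..m-1. r j)"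
      using lt that m le by (intro sum_strict_mono_ex1) auto
    finally show False using total lo by simp
  qed
  \<comment> \<open>Subtracting \<open>m\<close> times the length gives index \<open>m\<close> the
    coefficient 0, so the partial count \<open>b m\<close> need not be computed.\<close>
  have "weighted_sum k int b - int m * int \<alpha> = (\<Sum>i=1..k. (int i - int m) * int (b i))"
    unfolding weighted_sum_def total[symmetric]
    by (simp add: sum_distrib_left left_diff_distrib sum_subtractf)
  also have "\<dots> = (\<Sum>i=1..m. (int i - int m) * int (b i))"
    using above m by (intro sum.mono_neutral_right) auto
  also have "\<dots> = (\<Sum>i=1..m. (int i - int m) * int (r i))"
  proof (intro sum.cong refl)
    fix i assume "i \<in> {1..m}"
    then show "(int i - int m) * int (b i) = (int i - int m) * int (r i)"
      using below[of i] by (cases "i = m") auto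
  qed
  also have "\<dots> = (\<Sum>i=1..m. int i * int (r i)) - int m * (\<Sum>i=1..m. int (r i))"
    by (simp add: sum_distrib_left left_diff_distrib sum_subtractf)
  finally show ?thesis
    by (simp add: right_diff_distrib)
qed

lemma mult_vectors_down:
  assumes r: "\<forall>i\<in>{1..k}. r i \<ge> 1" and a: "0 < a 1" "strict_mono_on {1..k} a"
    and m: "m \<in> {1..k}"
    and lo: "(\<Sum>i=1..m-1. r i) \<le> \<alpha>" and hi: "\<alpha> < (\<Sum>i=1..m. r i)"
    and b: "b \<in> mult_vectors k r \<alpha>"
    and less: "(\<Sum>i=1..m. int i * int (r i)) - int m * ((\<Sum>i=1..m. int (r i)) - int \<alpha>)
      < weighted_sum k int b"
  shows "\<exists>b'\<in>mult_vectors k r \<alpha>. weighted_sum k int b' = weighted_sum k int b - 1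
    \<and> weighted_sum k a b' < weighted_sum k a b"
proof -
  consider (move) i where "Suc i \<in> {1..k}" "1 \<le> i" "b (Suc i) \<noteq> 0" "b i \<noteq> r i"
    | (remove) "b 1 \<noteq> 0" "(\<Sum>i=1..k. b i) \<noteq> \<alpha>"
  proof -
    have "\<not> ((\<forall>i. Suc i \<in> {1..k} \<longrightarrow> 1 \<le> i \<longrightarrow> b (Suc i) = 0 \<or> b i = r i)
        \<and> (b 1 = 0 \<or> (\<Sum>i=1..k. b i) = \<alpha>))"
      using weighted_sum_minimal_le[OF r m lo hi b] less[unfolded less_le_not_le] by blast
    then show ?thesis
      using that by blast
  qed
  then show ?thesis
  proof cases
    case move
    moreover have "a i < a (Suc i)"
      using a(2) move by (auto simp: strict_mono_on_def)
    moreover have "b i < r i"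
      using b move by (simp add: mult_vectors_def le_neq_implies_less)
    moreover have "b (Suc i) - 1 \<le> r (Suc i)"
      using b move by (auto simp: mult_vectors_def intro: le_trans[OF diff_le_self])
    ultimately show ?thesis
      using b
      by (intro bexI[of _ "b(i := b i + 1, Suc i := b (Suc i) - 1)"])
        (auto simp: mult_vectors_iff weighted_sum_upd)
  next
    case remove
    then have "int \<alpha> < weighted_sum k (\<lambda>_. 1) b"
      using b by (auto simp: mult_vectors_def weighted_sum_def simp flip: of_nat_sum)
    moreover have one: "1 \<in> {1..k}" using m by auto
    moreover have "b 1 - 1 \<le> r 1"
      using b one by (auto simp: mult_vectors_def intro: le_trans[OF diff_le_self])
    ultimately show ?thesis
      using b remove a
      by (intro bexI[of _ "b(1 := b 1 - 1)"])
        (auto simp: mult_vectors_iff weighted_sum_upd)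
  qed
qed

section \<open>Recovering the arithmetic progression\<close>

lemma dilate_interval_seq:
  assumes "\<And>i. i \<in> {1..k} \<Longrightarrow> a i = c * int i"
  shows "dilate_seq c (interval_seq 1 (int k) r) = rep_seq k a r"
proof -
  have "image_mset f (rep_seq k g r) = rep_seq k (\<lambda>i. f (g i)) r" for f :: "int \<Rightarrow> int" and g k
    by (induction k) (simp_all add: rep_seq_Suc, simp add: rep_seq_def)
  then show ?thesis
    using assms by (auto simp: dilate_seq_def interval_seq_def rep_seq_def intro!: sum.cong)
qed

theorem theorem3p5:
  fixes k m \<alpha> :: nat
    and r :: "nat \<Rightarrow> nat"
    and a :: "nat \<Rightarrow> int"
    and A :: "int multiset"
  assumes "k \<ge> 4"
    and "\<forall>i\<in>{1..k}. r i \<ge> 1"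
    and "int \<alpha> \<le> int (\<Sum>i=1..k. r i) - 2"
    and "m \<in> {1..k}"
    and "(\<Sum>i=1..m-1. r i) \<le> \<alpha>"
    and "\<alpha> < (\<Sum>i=1..m. r i)"
    and "A = rep_seq k a r"
    and "0 < a 1"
    and "strict_mono_on {1..k} a"
    and "int (card (subseq_sums \<alpha> A)) =
           (\<Sum>i=1..k. int i * int (r i)) - (\<Sum>i=1..m. int i * int (r i))
           + int m * ((\<Sum>i=1..m. int (r i)) - int \<alpha>) + 1"
  shows "A = dilate_seq (a 1) (interval_seq 1 (int k) r)"
proof -
  let ?C = "mult_vectors k r \<alpha>"
  let ?\<mu> = "(\<Sum>i=1..m. int i * int (r i)) - int m * ((\<Sum>i=1..m. int (r i)) - int \<alpha>)"
  note r = assms(2) and a = assms(8,9)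
  have rank: "weighted_sum k a p = weighted_sum k a q"
    if "p \<in> ?C" "q \<in> ?C" "weighted_sum k int p = weighted_sum k int q" for p q
  proof (rule equal_rank_imp_equal_value[where S = "subseq_sums \<alpha> A" and C = ?C and \<mu> = ?\<mu>
        and \<nu> = "weighted_sum k int r" and \<rho> = "weighted_sum k int"
        and v = "weighted_sum k a"])
    show "weighted_sum k a ` ?C \<subseteq> subseq_sums \<alpha> A"
      using weighted_sum_in_subseq_sums assms(7) by blast
    show "int (card (subseq_sums \<alpha> A)) \<le> weighted_sum k int r - ?\<mu> + 1"
      using assms(10) by (simp add: weighted_sum_def)
  qed (fact that finite_subseq_sums |
      rule mult_vectors_up[OF r a] mult_vectors_down[OF r a assms(4-6)]; assumption)+
  have size: "int \<alpha> \<le> weighted_sum k (\<lambda>_. 1) r - 2"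
    using assms(3) by (simp add: weighted_sum_def)
  \<comment> \<open>The bound \<open>\<alpha> \<le> (\<Sum>i=1..k. r i) - 2\<close> leaves room to
    omit two terms; their indices must differ, since \<open>r i\<close> may be 1.\<close>
  define omit where "omit i = r(i := r i - 1)" for i
  define omit2 where "omit2 i j = (omit i)(j := r j - 1)" for i j
  have omit: "omit i \<in> ?C" "weighted_sum k w (omit i) = weighted_sum k w r - w i"
    if "i \<in> {1..k}" for i w
    using that r size by (auto simp: omit_def mult_vectors_iff weighted_sum_upd)
  have omit2: "omit2 i j \<in> ?C" "weighted_sum k w (omit2 i j) = weighted_sum k w r - w i - w j"
    if "i \<in> {1..k}" "j \<in> {1..k}" "i \<noteq> j" for i j w
    using that r size
    by (auto simp: omit_def omit2_def mult_vectors_iff weighted_sum_upd)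
  \<comment> \<open>Omitting index \<open>Suc i\<close>, or \<open>i\<close> and 1 together, costs
    the same rank. Distinctness of \<open>i\<close> and 1 excludes \<open>i = 1\<close>.\<close>
  have Suc_eq: "a (Suc i) = a i + a 1" if "2 \<le> i" "Suc i \<le> k" for i
    using rank[of "omit (Suc i)" "omit2 i 1"] omit[of "Suc i"] omit2[of i 1] that by simp
  \<comment> \<open>The missing case \<open>a 2\<close> comes from the two pairs of distinct indices
    with sum 5; index 4 is where \<open>k \<ge> 4\<close> enters.\<close>
  have "a 2 + a 3 = a 1 + a 4"
    using rank[of "omit2 2 3" "omit2 1 4"] omit2[of 2 3] omit2[of 1 4] assms(1) by simp
  then have a2: "a 2 = 2 * a 1"
    using Suc_eq[of 3] assms(1) by simp
  have "a i = a 1 * int i" if "1 \<le> i" "i \<le> k" for i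
    using that
  proof (induction i rule: dec_induct)
    case (step i)
    then show ?case
      using Suc_eq[of i] a2 by (cases "i = 1") (auto simp: algebra_simps numeral_2_eq_2)
  qed simp
  then have "dilate_seq (a 1) (interval_seq 1 (int k) r) = rep_seq k a r"
    by (intro dilate_interval_seq) (meson atLeastAtMost_iff)
  then show ?thesis
    by (simp only: assms(7))
qed

end
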